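(* Let $\{P_i^A\}_{i=1}^{d_A^2}$ be a general SIC-POVM on $\mathbb{C}^{d_A}$ with parameter $a_A$, and let $\{P_j^B\}_{j=1}^{d_B^2}$ be a general SIC-POVM on $\mathbb{C}^{d_B}$ with parameter $a_B$. Let $\rho$ be a bipartite state on $\mathbb{C}^{d_A}\otimes\mathbb{C}^{d_B}$, and let $\mathcal{P}$ be the $d_A^2\times d_B^2$ matrix with entries $[\mathcal{P}]_{ij}=\mathrm{Tr}\big((P_i^A\otimes P_j^B)\rho\big)$. If $\rho$ is separable, then $$\|\mathcal{P}\|_{\mathrm{tr}}\leqslant \sqrt{\frac{a_A d_A^2+1}{d_A(d_A+1)}}\,\sqrt{\frac{a_B d_B^2+1}{d_B(d_B+1)}},$$ where $\|\mathcal{P}\|_{\mathrm{tr}}=\mathrm{Tr}\big(\sqrt{\mathcal{P}\mathcal{P}^\dagger}\big)$.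
   Context: A general SIC-POVM (general symmetric informationally complete measurement) on $\mathbb{C}^d$ with parameter $a$ is a family $\{P_\alpha\}_{\alpha=1}^{d^2}$ of $d^2$ positive semidefinite operators on $\mathbb{C}^d$ such that $\sum_{\alpha=1}^{d^2}P_\alpha=\mathbb{I}$, $\mathrm{Tr}(P_\alpha^2)=a$ for all $\alpha$, and $\mathrm{Tr}(P_\alpha P_\beta)=\frac{1-da}{d(d^2-1)}$ for all $\alpha\neq\beta$, where the parameter $a$ satisfies $\frac{1}{d^3}<a\leqslant\frac{1}{d^2}$ (in particular $d\geqslant 2$). A state on a finite-dimensional Hilbert space is a positive semidefinite operator of trace $1$. A bipartite state $\rho$ on $\mathbb{C}^{d_A}\otimes\mathbb{C}^{d_B}$ is separable if it is a finite convex combination of product states $\rho_A\otimes\rho_B$, with $\rho_A$ a state on $\mathbb{C}^{d_A}$ and $\rho_B$ a state on $\mathbb{C}^{d_B}$. *)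

theory Defs
  imports "Jordan_Normal_Form.Schur_Decomposition"
begin

definition mat_trace :: "complex mat \<Rightarrow> complex" where
  "mat_trace A = (\<Sum>i<dim_row A. A $$ (i, i))"

definition mat_sum :: "nat \<Rightarrow> (nat \<Rightarrow> complex mat) \<Rightarrow> nat set \<Rightarrow> complex mat" where
  "mat_sum n f I = mat n n (\<lambda>(k, l). \<Sum>i\<in>I. f i $$ (k, l))"

(* The basis vector e_i (x) e_k of the tensor product has index i * dim_row B + k. *)
definition tensor_mat :: "complex mat \<Rightarrow> complex mat \<Rightarrow> complex mat" where
  "tensor_mat A B = mat (dim_row A * dim_row B) (dim_col A * dim_col B)
     (\<lambda>(i, j). A $$ (i div dim_row B, j div dim_col B) * B $$ (i mod dim_row B, j mod dim_col B))"

(* For complex numbers, 0 \<le> z means that z is real and nonnegative (Complex_Order). *)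
definition psd :: "nat \<Rightarrow> complex mat \<Rightarrow> bool" where
  "psd n A \<longleftrightarrow> A \<in> carrier_mat n n \<and> mat_adjoint A = A \<and>
     (\<forall>v \<in> carrier_vec n. 0 \<le> (A *\<^sub>v v) \<bullet>c v)"

(* For positive semidefinite A such an R exists and is unique, so no actual choice is made. *)
definition psd_sqrt :: "complex mat \<Rightarrow> complex mat" where
  "psd_sqrt A = (SOME R. psd (dim_row A) R \<and> R * R = A)"

(* The trace of a positive semidefinite matrix is real; Re only changes the type. *)
definition trace_norm :: "complex mat \<Rightarrow> real" where
  "trace_norm A = Re (mat_trace (psd_sqrt (A * mat_adjoint A)))"

definition is_state :: "nat \<Rightarrow> complex mat \<Rightarrow> bool" where
  "is_state n \<rho> \<longleftrightarrow> psd n \<rho> \<and> mat_trace \<rho> = 1"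

definition separable :: "nat \<Rightarrow> nat \<Rightarrow> complex mat \<Rightarrow> bool" where
  "separable dA dB \<rho> \<longleftrightarrow>
     (\<exists>(m::nat) (p :: nat \<Rightarrow> real) \<sigma> \<tau>.
        (\<forall>k<m. 0 \<le> p k \<and> is_state dA (\<sigma> k) \<and> is_state dB (\<tau> k)) \<and>
        (\<Sum>k<m. p k) = 1 \<and>
        \<rho> = mat_sum (dA * dB) (\<lambda>k. complex_of_real (p k) \<cdot>\<^sub>m tensor_mat (\<sigma> k) (\<tau> k)) {..<m})"

(* The bounds on a force d \<ge> 2. *)
definition general_sic_povm :: "nat \<Rightarrow> real \<Rightarrow> (nat \<Rightarrow> complex mat) \<Rightarrow> bool" where
  "general_sic_povm d a P \<longleftrightarrow>
     1 / real d ^ 3 < a \<and> a \<le> 1 / real d ^ 2 \<and>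
     (\<forall>\<alpha><d^2. psd d (P \<alpha>)) \<and>
     mat_sum d P {..<d^2} = 1\<^sub>m d \<and>
     (\<forall>\<alpha><d^2. mat_trace (P \<alpha> * P \<alpha>) = complex_of_real a) \<and>
     (\<forall>\<alpha><d^2. \<forall>\<beta><d^2. \<alpha> \<noteq> \<beta> \<longrightarrow>
        mat_trace (P \<alpha> * P \<beta>) =
          complex_of_real ((1 - real d * a) / (real d * (real d ^ 2 - 1))))"

definition correlation_mat ::
  "nat \<Rightarrow> nat \<Rightarrow> (nat \<Rightarrow> complex mat) \<Rightarrow> (nat \<Rightarrow> complex mat) \<Rightarrow> complex mat \<Rightarrow> complex mat" where
  "correlation_mat dA dB PA PB \<rho> =
     mat (dA^2) (dB^2) (\<lambda>(i, j). mat_trace (tensor_mat (PA i) (PB j) * \<rho>))"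

end

(* For a state S, the square of the Hilbert-Schmidt distance from S to a real combination of the P i is
   nonnegative; taking the orthogonal projection of S and using Tr (S S) \<le> 1 bounds the Euclidean norm of
   the probability vector with entries Tr (P i S).  The correlation matrix of a separable state is a convex
   combination of outer products of such vectors, and the trace norm of a sum of outer products is at most
   the sum of the products of the norms.  For the last claim let e_i, l_i be the eigenvectors and eigenvalues
   of the square root of M M', where M' is the adjoint of M: the vectors M' e_i / l_i with l_i > 0 are
   orthonormal and l_i is the inner product of M' e_i with M' e_i / l_i, so that Cauchy-Schwarz and Bessel's
   inequality on both sides give the bound. *)
theory Submission
  imports Defs "HOL-Analysis.L2_Norm"
begin

section \<open>Entries of adjoints and products, and cyclicity of the trace\<close>

lemma adjoint_carrier: "A \<in> carrier_mat n m \<Longrightarrow> mat_adjoint A \<in> carrier_mat m n"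
  by (auto simp: mat_adjoint_def)

lemma adjoint_index:
  "A \<in> carrier_mat n m \<Longrightarrow> i < m \<Longrightarrow> j < n \<Longrightarrow> mat_adjoint (A :: complex mat) $$ (i, j) = cnj (A $$ (j, i))"
  by (auto simp: mat_adjoint_def mat_of_rows_index)

lemma mult_index:
  assumes "A \<in> carrier_mat n m" "B \<in> carrier_mat m l" "i < n" "j < l"
  shows "(A * B) $$ (i, j) = (\<Sum>k<m. A $$ (i, k) * B $$ (k, j))"
  using assms by (auto simp: scalar_prod_def atLeast0LessThan)

lemma adjoint_adjoint: "mat_adjoint (mat_adjoint A) = (A :: complex mat)"
proof -
  have A: "A \<in> carrier_mat (dim_row A) (dim_col A)" by simp
  note A' = adjoint_carrier[OF A] note A'' = adjoint_carrier[OF A']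
  show ?thesis
    by (rule eq_matI) (simp_all add: adjoint_index[OF A] adjoint_index[OF A'] carrier_matD[OF A'] carrier_matD[OF A''])
qed

lemma adjoint_mult:
  fixes A B :: "complex mat"
  assumes A: "A \<in> carrier_mat n m" and B: "B \<in> carrier_mat m l"
  shows "mat_adjoint (A * B) = mat_adjoint B * mat_adjoint A"
proof -
  note A' = adjoint_carrier[OF A] and B' = adjoint_carrier[OF B]
  have AB: "A * B \<in> carrier_mat n l" using A B by simp
  note AB' = adjoint_carrier[OF AB]
  have BA: "mat_adjoint B * mat_adjoint A \<in> carrier_mat l n" using A' B' by simp
  show ?thesis
  proof (rule eq_matI)
    fix i j assume "i < dim_row (mat_adjoint B * mat_adjoint A)" "j < dim_col (mat_adjoint B * mat_adjoint A)"
    then have ij: "i < l" "j < n" using BA by auto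
    show "mat_adjoint (A * B) $$ (i, j) = (mat_adjoint B * mat_adjoint A) $$ (i, j)"
      using ij by (simp add: adjoint_index[OF AB] mult_index[OF A B] mult_index[OF B' A']
        adjoint_index[OF A] adjoint_index[OF B] mult.commute del: index_mult_mat)
  qed (simp_all only: carrier_matD[OF AB'] carrier_matD[OF BA])
qed

lemma trace_mult:
  assumes "A \<in> carrier_mat n m" "B \<in> carrier_mat m n"
  shows "mat_trace (A * B) = (\<Sum>i<n. \<Sum>j<m. A $$ (i, j) * B $$ (j, i))"
  unfolding mat_trace_def using assms
  by (simp add: mult_index[OF assms] del: index_mult_mat(1))

lemma trace_mult_commute:
  assumes "A \<in> carrier_mat n m" "B \<in> carrier_mat m n"
  shows "mat_trace (A * B) = mat_trace (B * A)"
  unfolding trace_mult[OF assms] trace_mult[OF assms(2,1)]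
  by (subst sum.swap) (simp add: mult.commute)

section \<open>Orthonormal eigenvectors and the spectral theorem for Hermitian matrices\<close>

text \<open>By Schur triangularization \<open>A\<close> is similar to an upper triangular matrix
  whose diagonal entries are eigenvalues of \<open>A\<close>. Similarity preserves the trace, so if
  \<open>c\<close> were the only eigenvalue, the trace would be \<open>n\<close> times
  \<open>c\<close>.\<close>

lemma eigenvalue_neq:
  assumes A: "A \<in> carrier_mat n n" and c: "mat_trace A \<noteq> of_nat n * c"
  shows "\<exists>\<mu>. eigenvalue A \<mu> \<and> \<mu> \<noteq> c"
proof (rule ccontr)
  assume "\<not> ?thesis"
  then have all: "\<mu> = c" if "eigenvalue A \<mu>" for \<mu> using that by blast
  obtain as where as: "char_poly A = (\<Prod> a \<leftarrow> as. [:- a, 1:])"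
    using char_poly_factorized[OF A] by blast
  obtain B where B: "B \<in> carrier_mat n n" "upper_triangular B" "similar_mat A B"
    using schur_decomposition_exists[OF A as] by blast
  then obtain P Q where "similar_mat_wit A B P Q" unfolding similar_mat_def by blast
  note w = similar_mat_witD2[OF A this]
  have "mat_trace A = mat_trace (P * (B * Q))"
    using w by (simp add: assoc_mult_mat[OF w(6,5,7)])
  also have "\<dots> = mat_trace (B * Q * P)"
    using w by (intro trace_mult_commute) auto
  also have "B * Q * P = B" using w by (simp add: assoc_mult_mat[OF w(5,7,6)])
  also have "mat_trace B = (\<Sum>i<n. c)"
    unfolding mat_trace_def
  proof (rule sum.cong)
    fix i assume i: "i \<in> {..<n}"
    have "char_poly A = char_poly B" using B(3) by (rule char_poly_similar)
    also have "\<dots> = (\<Prod> a \<leftarrow> diag_mat B. [:- a, 1:])"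
      using char_poly_upper_triangular[OF B(1,2)] .
    finally have "poly (char_poly A) (B $$ (i,i)) = poly (\<Prod> a \<leftarrow> diag_mat B. [:- a, 1:]) (B $$ (i,i))" by simp
    also have "\<dots> = 0"
      using i B(1) by (force simp: poly_prod_list prod_list_zero_iff diag_mat_def)
    finally show "B $$ (i,i) = c"
      using all eigenvalue_root_char_poly[OF A] by blast
  qed (use B in auto)
  finally show False using c by simp
qed

text \<open>Induction on \<open>k\<close>, one new eigenvector at a time. Instead of restricting
  \<open>A\<close> to the orthogonal complement of the vectors found so far, the step changes the
  eigenvalues on their span, so that every matrix keeps size \<open>n\<close> and no change of basis
  occurs.\<close>

lemma orthonormal_eigensystem:
  fixes A :: "complex mat"
  assumes A: "A \<in> carrier_mat n n" and herm: "mat_adjoint A = A" and "k \<le> n"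
  shows "\<exists>(e :: nat \<Rightarrow> nat \<Rightarrow> complex) (l :: nat \<Rightarrow> real).
    (\<forall>i<k. \<forall>x<n. (\<Sum>y<n. A $$ (x, y) * e i y) = of_real (l i) * e i x) \<and>
    (\<forall>i<k. \<forall>j<k. (\<Sum>x<n. e i x * cnj (e j x)) = (if i = j then 1 else 0))"
  using \<open>k \<le> n\<close>
proof (induction k)
  case 0
  show ?case by simp
next
  case (Suc k)
  then obtain e and l :: "nat \<Rightarrow> real" where
    eig: "\<And>i x. i < k \<Longrightarrow> x < n \<Longrightarrow> (\<Sum>y<n. A $$ (x, y) * e i y) = of_real (l i) * e i x" and
    orth: "\<And>i j. i < k \<Longrightarrow> j < k \<Longrightarrow> (\<Sum>x<n. e i x * cnj (e j x)) = (if i = j then 1 else 0)"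
    using Suc.IH[OF Suc_leD[OF Suc.prems]] by blast
  have hermA: "A $$ (y, x) = cnj (A $$ (x, y))" if "x < n" "y < n" for x y
    using adjoint_index[OF A that(2,1)] herm by simp
  define T where "T = Re (mat_trace A) - (\<Sum>i<k. l i)"
  \<comment> \<open>The matrix \<open>D\<close> below has the \<open>e i\<close> as eigenvectors for \<open>c\<close>. For \<open>c \<noteq> T / (n - k)\<close> its trace is
    not \<open>n * c\<close>, so it has another eigenvalue, whose eigenvectors are orthogonal to all \<open>e i\<close>.\<close>
  define c where "c = T / (real n - real k) + 1"
  have nk: "real n - real k > 0" using Suc.prems by simp
  define D where "D = mat n n (\<lambda>(x, y). A $$ (x, y) - (\<Sum>i<k. of_real (l i - c) * (e i x * cnj (e i y))))"
  have D: "D \<in> carrier_mat n n" by (simp add: D_def)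
  have D_apply: "(\<Sum>y<n. D $$ (x, y) * v y) = (\<Sum>y<n. A $$ (x, y) * v y) -
      (\<Sum>i<k. of_real (l i - c) * e i x * (\<Sum>y<n. v y * cnj (e i y)))" if "x < n" for x v
  proof -
    have "(\<Sum>y<n. D $$ (x, y) * v y) = (\<Sum>y<n. A $$ (x, y) * v y) -
      (\<Sum>y<n. \<Sum>i<k. of_real (l i - c) * (e i x * cnj (e i y)) * v y)"
      using that by (simp add: D_def left_diff_distrib sum_subtractf sum_distrib_right)
    also have "(\<Sum>y<n. \<Sum>i<k. of_real (l i - c) * (e i x * cnj (e i y)) * v y)
        = (\<Sum>i<k. of_real (l i - c) * e i x * (\<Sum>y<n. v y * cnj (e i y)))"
      by (subst sum.swap) (simp add: sum_distrib_left mult_ac)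
    finally show ?thesis .
  qed
  have D_e: "(\<Sum>y<n. D $$ (x, y) * e j y) = of_real c * e j x" if "x < n" "j < k" for x j
  proof -
    have s: "(\<Sum>i<k. of_real (l i - c) * e i x * (\<Sum>y<n. e j y * cnj (e i y)))
      = of_real (l j - c) * e j x"
      using that by (simp add: orth if_distrib cong: if_cong)
    show ?thesis
      unfolding D_apply[OF that(1)] eig[OF that(2,1)] s by (simp add: left_diff_distrib)
  qed
  have hermD: "D $$ (y, x) = cnj (D $$ (x, y))" if "x < n" "y < n" for x y
    using that hermA[OF that] by (simp add: D_def mult.commute)
  \<comment> \<open>\<open>T\<close> is built from the real part of the trace; nothing is lost, as
    the trace of a Hermitian matrix is real.\<close>
  have trA: "mat_trace A = of_real (Re (mat_trace A))"
  proof -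
    have "cnj (mat_trace A) = mat_trace A"
      unfolding mat_trace_def cnj_sum using A by (intro sum.cong) (simp_all flip: hermA)
    then show ?thesis by (simp add: complex_eq_iff)
  qed
  have "mat_trace D = mat_trace A - (\<Sum>x<n. \<Sum>i<k. of_real (l i - c) * (e i x * cnj (e i x)))"
    using A by (simp add: mat_trace_def D_def sum_subtractf)
  also have "(\<Sum>x<n. \<Sum>i<k. of_real (l i - c) * (e i x * cnj (e i x))) = (\<Sum>i<k. of_real (l i - c) * (\<Sum>x<n. e i x * cnj (e i x)))"
    by (subst sum.swap) (simp add: sum_distrib_left)
  also have "\<dots> = of_real ((\<Sum>i<k. l i) - real k * c)"
    by (simp add: orth sum_subtractf)
  finally have trD: "mat_trace D = of_real (T + real k * c)"
    by (subst (asm) trA) (simp add: T_def)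
  have "T + real k * c \<noteq> real n * c"
  proof
    assume "T + real k * c = real n * c"
    then have "c = T / (real n - real k)" using nk by (simp add: field_simps)
    then show False by (simp add: c_def)
  qed
  then have "mat_trace D \<noteq> of_nat n * of_real c"
    unfolding trD by (metis of_real_eq_iff of_real_mult of_real_of_nat_eq)
  from eigenvalue_neq[OF D this] obtain \<mu> v where
    ev: "eigenvector D v \<mu>" and \<mu>: "\<mu> \<noteq> of_real c" unfolding eigenvalue_def by blast
  define f where "f x = v $ x" for x
  have v: "v \<in> carrier_vec n" "v \<noteq> 0\<^sub>v n" and Dv: "D *\<^sub>v v = \<mu> \<cdot>\<^sub>v v"
    using ev D unfolding eigenvector_def by auto
  have Df: "(\<Sum>y<n. D $$ (x, y) * f y) = \<mu> * f x" if "x < n" for x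
    using arg_cong[OF Dv, of "\<lambda>w. w $ x"] that v D
    by (simp add: scalar_prod_def f_def atLeast0LessThan)
  \<comment> \<open>Self-adjointness of \<open>D\<close>: the inner product of \<open>D g\<close>
    with \<open>h\<close> is that of \<open>g\<close> with \<open>D h\<close>. Taking
    \<open>g = h = f\<close> makes \<mu> real; taking \<open>g = f\<close> and
    \<open>h = e i\<close>, whose eigenvalue \<open>c\<close> differs from \<mu>, makes
    \<open>f\<close> orthogonal to \<open>e i\<close>.\<close>
  have sym: "(\<Sum>x<n. (\<Sum>y<n. D $$ (x, y) * g y) * cnj (h x)) = (\<Sum>y<n. g y * cnj (\<Sum>x<n. D $$ (y, x) * h x))" for g h
  proof -
    have "(\<Sum>x<n. (\<Sum>y<n. D $$ (x, y) * g y) * cnj (h x)) = (\<Sum>y<n. \<Sum>x<n. D $$ (x, y) * g y * cnj (h x))"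
      unfolding sum_distrib_right by (rule sum.swap)
    also have "\<dots> = (\<Sum>y<n. g y * cnj (\<Sum>x<n. D $$ (y, x) * h x))"
      by (auto simp: sum_distrib_left hermD[symmetric] mult_ac intro!: sum.cong)
    finally show ?thesis .
  qed
  define N where "N = (\<Sum>x<n. (cmod (f x))\<^sup>2)"
  have fN: "(\<Sum>x<n. f x * cnj (f x)) = of_real N"
    by (simp add: N_def complex_norm_square del: of_real_power)
  have "N > 0"
  proof -
    have "\<exists>x<n. f x \<noteq> 0"
    proof (rule ccontr)
      assume "\<not> ?thesis"
      then have "v = 0\<^sub>v n" using v(1) by (intro eq_vecI) (auto simp: f_def)
      with v(2) show False by simp
    qed
    then show ?thesis unfolding N_def by (auto intro!: sum_pos2)
  qed
  have \<mu>_real: "\<mu> = of_real (Re \<mu>)"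
  proof -
    have "(\<Sum>x<n. (\<Sum>y<n. D $$ (x, y) * f y) * cnj (f x)) = \<mu> * of_real N"
      unfolding fN[symmetric] sum_distrib_left by (simp add: Df mult.assoc)
    moreover have "(\<Sum>y<n. f y * cnj (\<Sum>x<n. D $$ (y, x) * f x)) = cnj \<mu> * of_real N"
      unfolding fN[symmetric] sum_distrib_left by (simp add: Df mult.left_commute del: cnj_sum)
    ultimately have "\<mu> * of_real N = cnj \<mu> * of_real N" using sym[of f f] by simp
    then have "cnj \<mu> = \<mu>" using \<open>N > 0\<close> by (metis mult_cancel_right of_real_eq_0_iff less_irrefl)
    then show ?thesis by (metis Reals_cnj_iff complex_is_Real_iff of_real_Re)
  qed
  have f_orth: "(\<Sum>y<n. f y * cnj (e i y)) = 0" if "i < k" for i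
  proof -
    have "(\<Sum>x<n. (\<Sum>y<n. D $$ (x, y) * f y) * cnj (e i x)) = \<mu> * (\<Sum>y<n. f y * cnj (e i y))"
      unfolding sum_distrib_left by (simp add: Df mult.assoc)
    moreover have "(\<Sum>y<n. f y * cnj (\<Sum>x<n. D $$ (y, x) * e i x)) = of_real c * (\<Sum>y<n. f y * cnj (e i y))"
      unfolding sum_distrib_left using that by (simp add: D_e mult.left_commute del: cnj_sum)
    ultimately have "\<mu> * (\<Sum>y<n. f y * cnj (e i y)) = of_real c * (\<Sum>y<n. f y * cnj (e i y))"
      using sym[of f "e i"] by simp
    then show ?thesis using \<mu> by simp
  qed
  have f_orth': "(\<Sum>y<n. e i y * cnj (f y)) = 0" if "i < k" for i
    using arg_cong[OF f_orth[OF that], of cnj] by (simp add: mult.commute)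
  \<comment> \<open>Since \<open>f\<close> is orthogonal to every \<open>e i\<close>, the correction
    terms in \<open>D\<close> vanish on \<open>f\<close>, so \<open>f\<close> is an eigenvector of
    \<open>A\<close> itself.\<close>
  have Af: "(\<Sum>y<n. A $$ (x, y) * f y) = of_real (Re \<mu>) * f x" if "x < n" for x
    using D_apply[OF that, of f] Df[OF that] f_orth \<mu>_real[symmetric] by simp
  define g where "g x = f x / of_real (sqrt N)" for x
  have sq: "complex_of_real (sqrt N) * of_real (sqrt N) = of_real N"
    using \<open>N > 0\<close> by (simp flip: of_real_mult)
  have gg: "(\<Sum>x<n. g x * cnj (g x)) = 1"
    using \<open>N > 0\<close> by (simp add: g_def sq fN flip: sum_divide_distrib)
  have ge: "(\<Sum>x<n. g x * cnj (e i x)) = 0" "(\<Sum>x<n. e i x * cnj (g x)) = 0" if "i < k" for i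
    using f_orth[OF that] f_orth'[OF that] by (simp_all add: g_def flip: sum_divide_distrib)
  have Ag: "(\<Sum>y<n. A $$ (x, y) * g y) = of_real (Re \<mu>) * g x" if "x < n" for x
    using Af[OF that] by (simp add: g_def flip: sum_divide_distrib)
  show ?case
  proof (intro exI conjI allI impI)
    fix i x assume "i < Suc k" "x < n"
    then show "(\<Sum>y<n. A $$ (x, y) * (e(k := g)) i y) = of_real ((l(k := Re \<mu>)) i) * (e(k := g)) i x"
      by (cases "i = k") (simp_all add: eig Ag)
  next
    fix i j assume "i < Suc k" "j < Suc k"
    then show "(\<Sum>x<n. (e(k := g)) i x * cnj ((e(k := g)) j x)) = (if i = j then 1 else 0)"
      by (cases "i = k"; cases "j = k") (simp_all add: orth gg ge)
  qed
qed

text \<open>The case \<open>k = n\<close>, with the eigenvectors as the columns of \<open>U\<close>.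
  Orthonormality makes \<open>mat_adjoint U\<close> a left inverse of \<open>U\<close>; for square
  matrices it is then a right inverse as well.\<close>

lemma hermitian_spectral:
  fixes A :: "complex mat"
  assumes A: "A \<in> carrier_mat n n" and herm: "mat_adjoint A = A"
  obtains U and l :: "nat \<Rightarrow> real" where "U \<in> carrier_mat n n" "U * mat_adjoint U = 1\<^sub>m n"
    "mat_adjoint U * U = 1\<^sub>m n" "A = U * mat_diag n (\<lambda>i. of_real (l i)) * mat_adjoint U"
proof -
  obtain e and l :: "nat \<Rightarrow> real" where
    eig: "\<And>i x. i < n \<Longrightarrow> x < n \<Longrightarrow> (\<Sum>y<n. A $$ (x, y) * e i y) = of_real (l i) * e i x" and
    orth: "\<And>i j. i < n \<Longrightarrow> j < n \<Longrightarrow> (\<Sum>x<n. e i x * cnj (e j x)) = (if i = j then 1 else 0)"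
    using orthonormal_eigensystem[OF A herm order.refl] by blast
  define U where "U = mat n n (\<lambda>(x, i). e i x)"
  have U: "U \<in> carrier_mat n n" by (simp add: U_def)
  have U_ix: "U $$ (x, i) = e i x" if "x < n" "i < n" for x i using that by (simp add: U_def)
  note U' = adjoint_carrier[OF U]
  have UU: "mat_adjoint U * U = 1\<^sub>m n"
  proof (rule eq_matI)
    fix i j assume "i < dim_row (1\<^sub>m n :: complex mat)" "j < dim_col (1\<^sub>m n :: complex mat)"
    then have ij: "i < n" "j < n" by auto
    then show "(mat_adjoint U * U) $$ (i, j) = 1\<^sub>m n $$ (i, j)"
      using orth[of j i]
      by (simp add: mult_index[OF U' U] adjoint_index[OF U] U_ix mult.commute del: index_mult_mat)
  qed (use U U' in auto)
  have UU': "U * mat_adjoint U = 1\<^sub>m n"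
    using mat_mult_left_right_inverse[OF U' U UU] .
  have L: "mat_diag n (\<lambda>i. complex_of_real (l i)) \<in> carrier_mat n n" by (rule mat_diag_dim)
  have AU: "A * U = U * mat_diag n (\<lambda>i. of_real (l i))"
  proof (rule eq_matI)
    fix i j assume "i < dim_row (U * mat_diag n (\<lambda>i. complex_of_real (l i)))" "j < dim_col (U * mat_diag n (\<lambda>i. complex_of_real (l i)))"
    then have ij: "i < n" "j < n" using U L by auto
    then show "(A * U) $$ (i, j) = (U * mat_diag n (\<lambda>i. of_real (l i))) $$ (i, j)"
      using eig[of j i] U
      by (simp add: mult_index[OF A U] mat_diag_mult_right[OF U] U_ix mult.commute del: index_mult_mat)
  qed (use A U carrier_matD[OF L] in simp_all)
  have "A = A * (U * mat_adjoint U)" using A by (simp add: UU')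
  also have "\<dots> = U * mat_diag n (\<lambda>i. of_real (l i)) * mat_adjoint U"
    by (simp add: assoc_mult_mat[OF A U U', symmetric] AU)
  finally show ?thesis using that U UU UU' by blast
qed

section \<open>Bessel's inequality\<close>

text \<open>Follows by expanding the squared norm of \<open>v - s\<close>, where \<open>s\<close> is
  the sum of the \<open>b i\<close> times \<open>g i\<close>. The squared lengths \<open>c i\<close>
  may be less than 1 because in the trace norm estimate some \<open>g i\<close> can be zero
  vectors.\<close>

lemma bessel_inequality:
  fixes g :: "nat \<Rightarrow> nat \<Rightarrow> complex" and c :: "nat \<Rightarrow> real"
  assumes orth: "\<And>i j. i < n \<Longrightarrow> j < n \<Longrightarrow> (\<Sum>y<m. g i y * cnj (g j y)) = (if i = j then of_real (c i) else 0)"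
    and c: "\<And>i. i < n \<Longrightarrow> c i \<le> 1"
  shows "(\<Sum>i<n. (cmod (\<Sum>y<m. v y * cnj (g i y)))\<^sup>2) \<le> (\<Sum>y<m. (cmod (v y))\<^sup>2)"
proof -
  define b where "b i = (\<Sum>y<m. v y * cnj (g i y))" for i
  define s where "s y = (\<Sum>i<n. b i * g i y)" for y
  let ?B = "\<Sum>i<n. (cmod (b i))\<^sup>2"
  have vs: "(\<Sum>y<m. v y * cnj (s y)) = of_real ?B"
  proof -
    have "(\<Sum>y<m. v y * cnj (s y)) = (\<Sum>i<n. \<Sum>y<m. cnj (b i) * (v y * cnj (g i y)))"
      unfolding s_def cnj_sum sum_distrib_left
      by (subst sum.swap) (simp add: mult_ac)
    also have "\<dots> = (\<Sum>i<n. b i * cnj (b i))"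
      unfolding sum_distrib_left[symmetric] b_def[symmetric] by (simp add: mult.commute)
    finally show ?thesis by (simp add: complex_norm_square del: of_real_power)
  qed
  have sv: "(\<Sum>y<m. s y * cnj (v y)) = of_real ?B"
    using arg_cong[OF vs, of cnj] by (simp add: mult.commute)
  have ss: "(\<Sum>y<m. s y * cnj (s y)) = of_real (\<Sum>i<n. c i * (cmod (b i))\<^sup>2)"
  proof -
    have "(\<Sum>y<m. s y * cnj (s y)) = (\<Sum>y<m. \<Sum>i<n. \<Sum>j<n. b i * cnj (b j) * (g i y * cnj (g j y)))"
      unfolding s_def cnj_sum sum_product by (simp add: mult_ac)
    also have "\<dots> = (\<Sum>i<n. \<Sum>j<n. b i * cnj (b j) * (\<Sum>y<m. g i y * cnj (g j y)))"
      unfolding sum_distrib_left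
      by (subst sum.swap) (intro sum.cong refl sum.swap)
    also have "\<dots> = (\<Sum>i<n. of_real (c i) * (b i * cnj (b i)))"
      by (intro sum.cong refl) (simp add: orth mult.commute if_distrib cong: if_cong)
    finally show ?thesis by (simp add: complex_norm_square del: of_real_power)
  qed
  have "of_real (\<Sum>y<m. (cmod (v y - s y))\<^sup>2) = (\<Sum>y<m. (v y - s y) * cnj (v y - s y))"
    by (simp add: complex_norm_square del: of_real_power complex_cnj_diff)
  also have "\<dots> = (\<Sum>y<m. v y * cnj (v y)) - (\<Sum>y<m. v y * cnj (s y)) - (\<Sum>y<m. s y * cnj (v y)) + (\<Sum>y<m. s y * cnj (s y))"
    by (simp add: algebra_simps sum.distrib sum_subtractf)
  also have "\<dots> = of_real ((\<Sum>y<m. (cmod (v y))\<^sup>2) - 2 * ?B + (\<Sum>i<n. c i * (cmod (b i))\<^sup>2))"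
    unfolding vs sv ss by (simp add: complex_norm_square del: of_real_power)
  finally have "(\<Sum>y<m. (cmod (v y - s y))\<^sup>2) = (\<Sum>y<m. (cmod (v y))\<^sup>2) - 2 * ?B + (\<Sum>i<n. c i * (cmod (b i))\<^sup>2)"
    by (simp only: of_real_eq_iff)
  moreover have "0 \<le> (\<Sum>y<m. (cmod (v y - s y))\<^sup>2)" by (intro sum_nonneg) simp
  moreover have "(\<Sum>i<n. c i * (cmod (b i))\<^sup>2) \<le> ?B"
    using mult_right_mono[OF c zero_le_power2] by (intro sum_mono) (simp only: lessThan_iff mult_1_left)
  ultimately show ?thesis unfolding b_def by linarith
qed

section \<open>Positive semidefinite matrices and their square roots\<close>

lemma psd_D:
  assumes "psd n A"
  shows "A \<in> carrier_mat n n" "mat_adjoint A = A"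
  using assms by (auto simp: psd_def)

lemma quadratic_form:
  assumes "A \<in> carrier_mat n n" "v \<in> carrier_vec n"
  shows "(A *\<^sub>v v) \<bullet>c v = (\<Sum>x<n. (\<Sum>y<n. A $$ (x, y) * v $ y) * cnj (v $ x))"
  using assms by (simp add: scalar_prod_def atLeast0LessThan)

lemma psd_mult_adjoint:
  assumes M: "M \<in> carrier_mat n m"
  shows "psd n (M * mat_adjoint M)"
  unfolding psd_def
proof (intro conjI ballI)
  note M' = adjoint_carrier[OF M]
  show MM: "M * mat_adjoint M \<in> carrier_mat n n" using M M' by simp
  show "mat_adjoint (M * mat_adjoint M) = M * mat_adjoint M"
    by (simp add: adjoint_mult[OF M M'] adjoint_adjoint)
  fix v :: "complex vec" assume v: "v \<in> carrier_vec n"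
  \<comment> \<open>\<open>w\<close> is the adjoint of \<open>M\<close> applied to \<open>v\<close>;
    the quadratic form turns out to be its squared norm.\<close>
  define w where "w k = (\<Sum>y<n. cnj (M $$ (y, k)) * v $ y)" for k
  have "(M * mat_adjoint M *\<^sub>v v) \<bullet>c v = (\<Sum>x<n. (\<Sum>y<n. (\<Sum>k<m. M $$ (x, k) * cnj (M $$ (y, k))) * v $ y) * cnj (v $ x))"
    unfolding quadratic_form[OF MM v]
    by (simp add: mult_index[OF M M'] adjoint_index[OF M] del: index_mult_mat)
  also have "\<dots> = (\<Sum>x<n. (\<Sum>k<m. M $$ (x, k) * w k) * cnj (v $ x))"
  proof -
    have "(\<Sum>y<n. (\<Sum>k<m. M $$ (x, k) * cnj (M $$ (y, k))) * v $ y) = (\<Sum>k<m. M $$ (x, k) * w k)" for x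
      unfolding w_def sum_distrib_left sum_distrib_right by (subst sum.swap) (simp add: mult.assoc)
    then show ?thesis by simp
  qed
  also have "\<dots> = (\<Sum>k<m. \<Sum>x<n. w k * (M $$ (x, k) * cnj (v $ x)))"
    unfolding sum_distrib_right by (subst sum.swap) (simp add: mult_ac)
  also have "\<dots> = (\<Sum>k<m. w k * cnj (w k))"
    by (simp add: w_def flip: sum_distrib_left)
  also have "0 \<le> \<dots>" 
    using conjugate_square_positive[of "w _"] by (intro sum_nonneg) (simp only: conjugate_complex_def)
  finally show "0 \<le> (M * mat_adjoint M *\<^sub>v v) \<bullet>c v" .
qed

text \<open>Each \<open>l i\<close> is the value of the quadratic form of \<open>A\<close> at the
  unit vector \<open>col U i\<close>, hence nonnegative.\<close>

lemma psd_spectral: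
  assumes "psd n A"
  obtains U and l :: "nat \<Rightarrow> real" where "U \<in> carrier_mat n n" "U * mat_adjoint U = 1\<^sub>m n"
    "mat_adjoint U * U = 1\<^sub>m n" "A = U * mat_diag n (\<lambda>i. of_real (l i)) * mat_adjoint U"
    "\<And>i. i < n \<Longrightarrow> 0 \<le> l i"
proof -
  note A = psd_D[OF assms]
  obtain U and l :: "nat \<Rightarrow> real" where U: "U \<in> carrier_mat n n" "U * mat_adjoint U = 1\<^sub>m n"
    "mat_adjoint U * U = 1\<^sub>m n" and eq: "A = U * mat_diag n (\<lambda>i. of_real (l i)) * mat_adjoint U"
    using hermitian_spectral[OF A] .
  note U' = adjoint_carrier[OF U(1)]
  define L where "L = mat_diag n (\<lambda>i. complex_of_real (l i))"
  have L: "L \<in> carrier_mat n n" unfolding L_def by (rule mat_diag_dim)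
  have AU: "A * U = U * L"
    unfolding eq L_def[symmetric] using U L U'
    by (simp add: assoc_mult_mat[of _ n n _ n _ n])
  have "0 \<le> l i" if i: "i < n" for i
  proof -
    have c: "col U i \<in> carrier_vec n" using U(1) by (rule col_carrier_vec[OF i])
    have "(A *\<^sub>v col U i) \<bullet>c col U i = (\<Sum>x<n. (A * U) $$ (x, i) * cnj (U $$ (x, i)))"
      unfolding quadratic_form[OF A(1) c] using i U(1)
      by (simp add: mult_index[OF A(1) U(1)] del: index_mult_mat)
    also have "\<dots> = of_real (l i) * (\<Sum>x<n. mat_adjoint U $$ (i, x) * U $$ (x, i))"
      unfolding AU sum_distrib_left L_def using i
      by (intro sum.cong refl) (simp add: mat_diag_mult_right[OF U(1)] adjoint_index[OF U(1)])
    also have "(\<Sum>x<n. mat_adjoint U $$ (i, x) * U $$ (x, i)) = 1"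
      using mult_index[OF U' U(1) i i] i by (simp add: U(3))
    finally have "complex_of_real (l i) = (A *\<^sub>v col U i) \<bullet>c col U i" by simp
    also have "0 \<le> \<dots>" using assms c by (auto simp: psd_def)
    finally show ?thesis by (simp add: less_eq_complex_def)
  qed
  with U eq show ?thesis using that by blast
qed

text \<open>\<open>psd_sqrt\<close> is a choice by \<open>SOME\<close>, so one witness passes both
  properties on to the chosen root. The witness \<open>R\<close> has the square roots of the
  eigenvalues of \<open>A\<close> in an orthonormal eigenbasis of \<open>A\<close>.\<close>

lemma psd_sqrt:
  assumes "psd n A"
  shows "psd n (psd_sqrt A)" "psd_sqrt A * psd_sqrt A = A"
proof -
  obtain U and l :: "nat \<Rightarrow> real" where U: "U \<in> carrier_mat n n" "U * mat_adjoint U = 1\<^sub>m n"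
    "mat_adjoint U * U = 1\<^sub>m n" and eq: "A = U * mat_diag n (\<lambda>i. of_real (l i)) * mat_adjoint U"
    and l: "\<And>i. i < n \<Longrightarrow> 0 \<le> l i"
    using psd_spectral[OF assms] by blast
  note U' = adjoint_carrier[OF U(1)]
  define D where "D s = mat_diag n (\<lambda>i. complex_of_real (s i))" for s
  have D: "D s \<in> carrier_mat n n" for s unfolding D_def by (rule mat_diag_dim)
  have DD: "D s * D t = D (\<lambda>i. s i * t i)" for s t by (simp add: D_def mat_diag_diag)
  have D_cong: "D s = D t" if "\<And>i. i < n \<Longrightarrow> s i = t i" for s t
    unfolding D_def using that by (auto simp: mat_diag_def)
  have D_adj: "mat_adjoint (D s) = D s" for s
    unfolding D_def mat_diag_def by (rule eq_matI) (auto simp: mat_adjoint_def mat_of_rows_index)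
  note assoc = assoc_mult_mat[of _ n n _ n _ n] mult_carrier_mat[of _ n n _ n]
  define R where "R = U * D (\<lambda>i. sqrt (l i)) * mat_adjoint U"
  have "R * R = U * (D (\<lambda>i. sqrt (l i)) * ((mat_adjoint U * U) * (D (\<lambda>i. sqrt (l i)) * mat_adjoint U)))"
    unfolding R_def using U(1) U' D by (simp add: assoc)
  also have "\<dots> = U * ((D (\<lambda>i. sqrt (l i)) * D (\<lambda>i. sqrt (l i))) * mat_adjoint U)"
    unfolding U(3) using U(1) U' D by (simp add: assoc left_mult_one_mat[of _ n n])
  also have "D (\<lambda>i. sqrt (l i)) * D (\<lambda>i. sqrt (l i)) = D l"
    unfolding DD by (rule D_cong) (simp add: l)
  also have "U * (D l * mat_adjoint U) = A"
    unfolding eq D_def[symmetric] using U(1) U' D by (simp add: assoc)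
  finally have RR: "R * R = A" .
  \<comment> \<open>Fourth roots of the original matrix: \<open>R\<close> is \<open>N\<close> times
    its adjoint, hence positive semidefinite.\<close>
  define N where "N = U * D (\<lambda>i. sqrt (sqrt (l i)))"
  have N: "N \<in> carrier_mat n n" unfolding N_def using U(1) D by simp
  have "N * mat_adjoint N = U * ((D (\<lambda>i. sqrt (sqrt (l i))) * D (\<lambda>i. sqrt (sqrt (l i)))) * mat_adjoint U)"
    unfolding N_def adjoint_mult[OF U(1) D] D_adj using U(1) U' D by (simp add: assoc)
  also have "D (\<lambda>i. sqrt (sqrt (l i))) * D (\<lambda>i. sqrt (sqrt (l i))) = D (\<lambda>i. sqrt (l i))"
    unfolding DD by (rule D_cong) (simp add: l)
  also have "U * (D (\<lambda>i. sqrt (l i)) * mat_adjoint U) = R"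
    unfolding R_def using U(1) U' D by (simp add: assoc)
  finally have "psd n R" using psd_mult_adjoint[OF N] by simp
  then have "psd (dim_row A) R \<and> R * R = A" using RR psd_D(1)[OF assms] by simp
  then have "psd (dim_row A) (psd_sqrt A) \<and> psd_sqrt A * psd_sqrt A = A"
    unfolding psd_sqrt_def by (rule someI)
  then show "psd n (psd_sqrt A)" "psd_sqrt A * psd_sqrt A = A"
    using psd_D(1)[OF assms] by auto
qed

section \<open>The trace norm of a sum of outer products\<close>

lemma trace_unitary_conj:
  assumes U: "U \<in> carrier_mat n n" "mat_adjoint U * U = 1\<^sub>m n"
  shows "mat_trace (U * mat_diag n f * mat_adjoint U) = (\<Sum>i<n. f i)"
proof -
  note U' = adjoint_carrier[OF U(1)]
  have D: "mat_diag n f \<in> carrier_mat n n" by (rule mat_diag_dim)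
  have "mat_trace (U * mat_diag n f * mat_adjoint U) = mat_trace (mat_adjoint U * (U * mat_diag n f))"
    using U(1) U' D by (intro trace_mult_commute) auto
  also have "mat_adjoint U * (U * mat_diag n f) = mat_diag n f"
    by (simp add: assoc_mult_mat[OF U' U(1) D, symmetric] U(2) left_mult_one_mat[OF D])
  finally show ?thesis by (simp add: mat_trace_def mat_diag_def)
qed

text \<open>Combines the triangle inequality for the trace norm with its value on outer products
  (the second factor is not conjugated). Any decomposition of \<open>M\<close> into outer products,
  such as the one that a separable state provides, gives a bound.\<close>

lemma trace_norm_le:
  fixes M :: "complex mat" and u v :: "nat \<Rightarrow> nat \<Rightarrow> complex"
  assumes M: "M \<in> carrier_mat n m"
    and M_eq: "\<And>x y. x < n \<Longrightarrow> y < m \<Longrightarrow> M $$ (x, y) = (\<Sum>k<K. u k x * v k y)"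
  shows "trace_norm M \<le> (\<Sum>k<K. sqrt (\<Sum>x<n. (cmod (u k x))\<^sup>2) * sqrt (\<Sum>y<m. (cmod (v k y))\<^sup>2))"
proof -
  note M' = adjoint_carrier[OF M]
  define R where "R = psd_sqrt (M * mat_adjoint M)"
  have R: "psd n R" and RR: "R * R = M * mat_adjoint M"
    unfolding R_def by (rule psd_sqrt[OF psd_mult_adjoint[OF M]])+
  obtain U and l :: "nat \<Rightarrow> real" where U: "U \<in> carrier_mat n n" "U * mat_adjoint U = 1\<^sub>m n"
    "mat_adjoint U * U = 1\<^sub>m n" and eq: "R = U * mat_diag n (\<lambda>i. of_real (l i)) * mat_adjoint U"
    and l: "\<And>i. i < n \<Longrightarrow> 0 \<le> l i"
    using psd_spectral[OF R] by blast
  note U' = adjoint_carrier[OF U(1)]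
  have tr: "trace_norm M = (\<Sum>i<n. l i)"
    unfolding trace_norm_def R_def[symmetric] unfolding eq trace_unitary_conj[OF U(1,3)] by simp
  define L where "L = mat_diag n (\<lambda>i. complex_of_real (l i))"
  have L: "L \<in> carrier_mat n n" unfolding L_def by (rule mat_diag_dim)
  note assoc = assoc_mult_mat[of _ n n _ n _ n] mult_carrier_mat[of _ n n _ n]
  \<comment> \<open>Row \<open>i\<close> of \<open>C\<close> is the conjugate of M' e_i, where e_i
    is column \<open>i\<close> of \<open>U\<close> and M' the adjoint of \<open>M\<close>. As M M'
    is the square of \<open>R\<close>, these rows are orthogonal with norms
    \<open>l i\<close>.\<close>
  define C where "C = mat_adjoint U * M"
  have C: "C \<in> carrier_mat n m" unfolding C_def using U' M by simp
  note C' = adjoint_carrier[OF C]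
  have "C * mat_adjoint C = mat_adjoint U * (M * mat_adjoint M) * U"
    unfolding C_def adjoint_mult[OF U' M] adjoint_adjoint
    using assoc_mult_mat[OF U' M, of "mat_adjoint M * U" n] assoc_mult_mat[OF M M' U(1)]
      assoc_mult_mat[OF U', of "M * mat_adjoint M" n U n] U U' M M' by simp
  also have "\<dots> = (mat_adjoint U * U) * (L * ((mat_adjoint U * U) * (L * (mat_adjoint U * U))))"
    unfolding RR[symmetric] eq L_def[symmetric] using U(1) U' L by (simp add: assoc)
  also have "\<dots> = L * L" unfolding U(3) using L by simp
  also have "\<dots> = mat_diag n (\<lambda>i. of_real (l i * l i))" unfolding L_def by (simp add: mat_diag_diag)
  finally have CC': "C * mat_adjoint C = mat_diag n (\<lambda>i. of_real (l i * l i))" .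
  have CC: "(\<Sum>y<m. C $$ (i, y) * cnj (C $$ (j, y))) = (if i = j then of_real (l i * l i) else 0)"
    if "i < n" "j < n" for i j
  proof -
    have "(\<Sum>y<m. C $$ (i, y) * cnj (C $$ (j, y))) = (C * mat_adjoint C) $$ (i, j)"
      using mult_index[OF C C' that] that by (simp add: adjoint_index[OF C] del: index_mult_mat)
    then show ?thesis
      unfolding CC' using that by (simp add: mat_diag_def)
  qed
  \<comment> \<open>The nonzero \<open>g i\<close> are orthonormal. Where \<open>l i = 0\<close>,
    division by zero makes \<open>g i\<close> the zero vector: its inner product with row
    \<open>i\<close> of \<open>C\<close> is still \<open>l i\<close>, and Bessel's inequality
    applies with squared length 0.\<close>
  define g where "g i y = C $$ (i, y) / of_real (l i)" for i y
  define a where "a k i = (\<Sum>x<n. u k x * cnj (U $$ (x, i)))" for k i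
  define b where "b k i = (\<Sum>y<m. v k y * cnj (g i y))" for k i
  \<comment> \<open>Inserting the outer products for \<open>M\<close> splits the inner product of
    row \<open>i\<close> of \<open>C\<close> with \<open>g i\<close> into one term per
    \<open>k\<close>: the coefficient of \<open>u k\<close> at column \<open>i\<close> of
    \<open>U\<close> times that of \<open>v k\<close> at \<open>g i\<close>.\<close>
  have l_eq: "of_real (l i) = (\<Sum>k<K. a k i * b k i)" if i: "i < n" for i
  proof -
    have "of_real (l i) = (\<Sum>y<m. C $$ (i, y) * cnj (g i y))"
      using CC[OF i i] by (cases "l i = 0") (simp_all add: g_def flip: sum_divide_distrib)
    also have "\<dots> = (\<Sum>y<m. (\<Sum>x<n. cnj (U $$ (x, i)) * (\<Sum>k<K. u k x * v k y)) * cnj (g i y))"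
      using i by (simp add: C_def mult_index[OF U' M] adjoint_index[OF U(1)] M_eq del: index_mult_mat)
    also have "\<dots> = (\<Sum>y<m. \<Sum>x<n. \<Sum>k<K. (u k x * cnj (U $$ (x, i))) * (v k y * cnj (g i y)))"
      by (simp add: sum_distrib_left sum_distrib_right mult_ac)
    also have "\<dots> = (\<Sum>y<m. \<Sum>k<K. \<Sum>x<n. (u k x * cnj (U $$ (x, i))) * (v k y * cnj (g i y)))"
      by (intro sum.cong refl sum.swap)
    also have "\<dots> = (\<Sum>k<K. \<Sum>y<m. \<Sum>x<n. (u k x * cnj (U $$ (x, i))) * (v k y * cnj (g i y)))"
      by (rule sum.swap)
    also have "\<dots> = (\<Sum>k<K. a k i * b k i)"
      unfolding a_def b_def by (simp add: sum_product) (intro sum.cong refl sum.swap)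
    finally show ?thesis .
  qed
  have a_le: "(\<Sum>i<n. (cmod (a k i))\<^sup>2) \<le> (\<Sum>x<n. (cmod (u k x))\<^sup>2)" for k
    unfolding a_def
  proof (rule bessel_inequality)
    fix i j assume ij: "i < n" "j < n"
    show "(\<Sum>x<n. U $$ (x, i) * cnj (U $$ (x, j))) = (if i = j then of_real 1 else 0)"
      using mult_index[OF U' U(1) ij(2,1), symmetric] ij by (auto simp: U(3) adjoint_index[OF U(1)] mult.commute)
  qed simp
  have b_le: "(\<Sum>i<n. (cmod (b k i))\<^sup>2) \<le> (\<Sum>y<m. (cmod (v k y))\<^sup>2)" for k
    unfolding b_def
  proof (rule bessel_inequality)
    fix i j assume ij: "i < n" "j < n"
    show "(\<Sum>y<m. g i y * cnj (g j y)) = (if i = j then of_real (if l i = 0 then 0 else 1) else 0)"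
      using CC[OF ij] by (simp add: g_def flip: sum_divide_distrib)
  qed simp
  have "trace_norm M = Re (\<Sum>i<n. \<Sum>k<K. a k i * b k i)"
    unfolding tr by (simp flip: l_eq)
  also have "\<dots> \<le> cmod (\<Sum>k<K. \<Sum>i<n. a k i * b k i)"
    by (subst sum.swap) (rule complex_Re_le_cmod)
  \<comment> \<open>The absolute values around the moduli give the terms the form of
    \<open>L2_set_mult_ineq\<close>, the Cauchy-Schwarz inequality over \<open>i\<close> for each
    fixed \<open>k\<close>.\<close>
  also have "\<dots> \<le> (\<Sum>k<K. \<Sum>i<n. \<bar>cmod (a k i)\<bar> * \<bar>cmod (b k i)\<bar>)"
    by (intro order.trans[OF norm_sum] sum_mono) (simp add: norm_mult)
  also have "\<dots> \<le> (\<Sum>k<K. L2_set (\<lambda>i. cmod (a k i)) {..<n} * L2_set (\<lambda>i. cmod (b k i)) {..<n})"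
    by (intro sum_mono L2_set_mult_ineq)
  also have "\<dots> \<le> (\<Sum>k<K. sqrt (\<Sum>x<n. (cmod (u k x))\<^sup>2) * sqrt (\<Sum>y<m. (cmod (v k y))\<^sup>2))"
    unfolding L2_set_def
    by (intro sum_mono mult_mono real_sqrt_le_mono a_le b_le) (auto intro!: sum_nonneg)
  finally show ?thesis .
qed

section \<open>Hilbert-Schmidt inner products of Hermitian matrices, and the purity of a
  state\<close>

lemma hermitian_index:
  assumes "A \<in> carrier_mat n n" "mat_adjoint A = A" "i < n" "j < n"
  shows "cnj (A $$ (i, j)) = (A :: complex mat) $$ (j, i)"
  using adjoint_index[OF assms(1,4,3)] assms(2) by simp

text \<open>Conjugation reverses the two factors under the trace, and cyclicity reverses them
  back.\<close>

lemma trace_mult_hermitian_real: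
  assumes "A \<in> carrier_mat n n" "mat_adjoint A = A" "B \<in> carrier_mat n n" "mat_adjoint B = B"
  shows "mat_trace (A * B) = of_real (Re (mat_trace (A * B)))"
proof -
  have "cnj (mat_trace (A * B)) = mat_trace (B * A)"
    unfolding trace_mult[OF assms(1,3)] trace_mult[OF assms(3,1)] cnj_sum
    by (auto intro!: sum.cong simp: hermitian_index[OF assms(1,2)] hermitian_index[OF assms(3,4)] mult.commute)
  also have "\<dots> = mat_trace (A * B)" by (rule trace_mult_commute[OF assms(3,1)])
  finally have "mat_trace (A * B) \<in> \<real>" by (simp add: Reals_cnj_iff)
  then show ?thesis by simp
qed

text \<open>The eigenvalues are nonnegative with sum 1, so each is at most that sum, and their
  squares add up to at most 1.\<close>

lemma state_purity_le:
  assumes "is_state n \<rho>"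
  shows "Re (mat_trace (\<rho> * \<rho>)) \<le> 1"
proof -
  have psd: "psd n \<rho>" and tr: "mat_trace \<rho> = 1" using assms by (auto simp: is_state_def)
  obtain U and l :: "nat \<Rightarrow> real" where U: "U \<in> carrier_mat n n" "U * mat_adjoint U = 1\<^sub>m n"
    "mat_adjoint U * U = 1\<^sub>m n" and eq: "\<rho> = U * mat_diag n (\<lambda>i. of_real (l i)) * mat_adjoint U"
    and l: "\<And>i. i < n \<Longrightarrow> 0 \<le> l i"
    using psd_spectral[OF psd] by blast
  note U' = adjoint_carrier[OF U(1)]
  define L where "L = mat_diag n (\<lambda>i. complex_of_real (l i))"
  have L: "L \<in> carrier_mat n n" unfolding L_def by (rule mat_diag_dim)
  note assoc = assoc_mult_mat[of _ n n _ n _ n] mult_carrier_mat[of _ n n _ n]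
  have "\<rho> * \<rho> = U * (L * ((mat_adjoint U * U) * (L * mat_adjoint U)))"
    unfolding eq L_def[symmetric] using U(1) U' L by (simp add: assoc)
  also have "\<dots> = U * (L * L) * mat_adjoint U"
    unfolding U(3) using U(1) U' L by (simp add: assoc left_mult_one_mat[of _ n n])
  also have "L * L = mat_diag n (\<lambda>i. of_real ((l i)\<^sup>2))"
    by (simp add: L_def mat_diag_diag power2_eq_square)
  finally have "mat_trace (\<rho> * \<rho>) = of_real (\<Sum>i<n. (l i)\<^sup>2)"
    by (simp only: trace_unitary_conj[OF U(1,3)] of_real_sum)
  moreover have "complex_of_real (\<Sum>i<n. l i) = 1"
    using tr unfolding eq trace_unitary_conj[OF U(1,3)] by simp
  then have "(\<Sum>i<n. l i) = 1" by (simp only: of_real_eq_1_iff)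
  moreover have "(\<Sum>i<n. (l i)\<^sup>2) \<le> (\<Sum>i<n. l i * (\<Sum>j<n. l j))"
    unfolding power2_eq_square using l
    by (intro sum_mono mult_left_mono member_le_sum) auto
  ultimately show ?thesis by (simp flip: sum_distrib_right)
qed

lemma mat_sum_carrier: "mat_sum n f I \<in> carrier_mat n n"
  by (simp add: mat_sum_def)

lemma trace_mult_mat_sum:
  assumes "A \<in> carrier_mat n n" "\<And>i. i \<in> I \<Longrightarrow> f i \<in> carrier_mat n n"
  shows "mat_trace (A * mat_sum n f I) = (\<Sum>i\<in>I. mat_trace (A * f i))"
proof -
  have "mat_trace (A * mat_sum n f I) = (\<Sum>x<n. \<Sum>y<n. \<Sum>i\<in>I. A $$ (x, y) * f i $$ (y, x))"
    unfolding trace_mult[OF assms(1) mat_sum_carrier] by (simp add: mat_sum_def sum_distrib_left)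
  also have "\<dots> = (\<Sum>x<n. \<Sum>i\<in>I. \<Sum>y<n. A $$ (x, y) * f i $$ (y, x))"
    by (intro sum.cong refl sum.swap)
  also have "\<dots> = (\<Sum>i\<in>I. \<Sum>x<n. \<Sum>y<n. A $$ (x, y) * f i $$ (y, x))"
    by (rule sum.swap)
  also have "\<dots> = (\<Sum>i\<in>I. mat_trace (A * f i))"
    by (intro sum.cong refl) (simp only: trace_mult[OF assms(1) assms(2)])
  finally show ?thesis .
qed

lemma trace_mult_smult:
  assumes "A \<in> carrier_mat n n" "B \<in> carrier_mat n n"
  shows "mat_trace (A * (c \<cdot>\<^sub>m B)) = c * mat_trace (A * B)"
  unfolding mult_smult_distrib[OF assms] using assms by (simp add: mat_trace_def sum_distrib_left)

text \<open>Expands the squared Hilbert-Schmidt distance between \<open>S\<close> and the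
  combination \<open>X\<close> of the \<open>P i\<close> with coefficients \<open>x i\<close>. Real
  coefficients keep \<open>X\<close> Hermitian, so conjugated entries become transposed ones and the
  sums become traces of products.\<close>

lemma hilbert_schmidt_expand:
  fixes P :: "nat \<Rightarrow> complex mat" and x :: "nat \<Rightarrow> real"
  assumes S: "S \<in> carrier_mat n n" "mat_adjoint S = S"
    and P: "\<And>i. i < N \<Longrightarrow> P i \<in> carrier_mat n n" "\<And>i. i < N \<Longrightarrow> mat_adjoint (P i) = P i"
  shows "2 * (\<Sum>i<N. x i * Re (mat_trace (P i * S)))
    \<le> Re (mat_trace (S * S)) + (\<Sum>i<N. \<Sum>j<N. x i * x j * Re (mat_trace (P i * P j)))"
proof -
  define X where "X = mat_sum n (\<lambda>i. of_real (x i) \<cdot>\<^sub>m P i) {..<N}"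
  have X: "X \<in> carrier_mat n n" unfolding X_def by (rule mat_sum_carrier)
  have X_ix: "X $$ (k, l) = (\<Sum>i<N. of_real (x i) * P i $$ (k, l))" if "k < n" "l < n" for k l
    using that by (simp add: X_def mat_sum_def carrier_matD[OF P(1)])
  have X_herm: "cnj (X $$ (k, l)) = X $$ (l, k)" if "k < n" "l < n" for k l
    using that by (auto simp: X_ix hermitian_index[OF P] intro!: sum.cong)
  have AX: "mat_trace (A * X) = (\<Sum>i<N. of_real (x i) * mat_trace (A * P i))" if "A \<in> carrier_mat n n" for A
    unfolding X_def using that P(1) by (subst trace_mult_mat_sum) (auto simp: trace_mult_smult)
  have XS: "mat_trace (S * X) = (\<Sum>i<N. of_real (x i) * mat_trace (P i * S))"
    unfolding AX[OF S(1)] using trace_mult_commute[OF S(1) P(1)] by (intro sum.cong) auto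
  have "mat_trace (X * P i) = (\<Sum>j<N. of_real (x j) * mat_trace (P i * P j))" if "i < N" for i
    using AX[OF P(1)[OF that]] trace_mult_commute[OF X P(1)[OF that]] by simp
  then have XX: "mat_trace (X * X) = (\<Sum>i<N. \<Sum>j<N. of_real (x i * x j) * mat_trace (P i * P j))"
    unfolding AX[OF X] by (simp add: sum_distrib_left mult.assoc)
  have "0 \<le> (\<Sum>k<n. \<Sum>l<n. (cmod (X $$ (k, l) - S $$ (k, l)))\<^sup>2)"
    by (intro sum_nonneg) simp
  also have "\<dots> = Re (\<Sum>k<n. \<Sum>l<n. (X $$ (k, l) - S $$ (k, l)) * cnj (X $$ (k, l) - S $$ (k, l)))"
    unfolding complex_norm_square[symmetric] of_real_sum[symmetric] by (simp only: Re_complex_of_real)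
  also have "(\<Sum>k<n. \<Sum>l<n. (X $$ (k, l) - S $$ (k, l)) * cnj (X $$ (k, l) - S $$ (k, l)))
    = (\<Sum>k<n. \<Sum>l<n. X $$ (k, l) * X $$ (l, k) - X $$ (k, l) * S $$ (l, k) - S $$ (k, l) * X $$ (l, k) + S $$ (k, l) * S $$ (l, k))"
    by (intro sum.cong refl) (simp add: X_herm hermitian_index[OF S] algebra_simps)
  also have "\<dots> = mat_trace (X * X) - mat_trace (X * S) - mat_trace (S * X) + mat_trace (S * S)"
    unfolding trace_mult[OF X X] trace_mult[OF X S(1)] trace_mult[OF S(1) X] trace_mult[OF S(1) S(1)]
    by (simp only: sum.distrib sum_subtractf)
  also have "mat_trace (X * S) = mat_trace (S * X)" by (rule trace_mult_commute[OF X S(1)])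
  finally show ?thesis unfolding XX XS by (simp del: of_real_mult)
qed

section \<open>Probability vectors of a general SIC-POVM\<close>

text \<open>The Gram matrix of the \<open>P i\<close> is (a - b) I + b J with J the all-ones matrix,
  so the projection of \<open>S\<close> onto their span has explicit coefficients, affine in the
  probabilities \<open>q i\<close>.\<close>

lemma general_sic_povm_bound:
  assumes P: "general_sic_povm d a P" and S: "is_state d S"
  shows "(\<Sum>i<d\<^sup>2. (cmod (mat_trace (P i * S)))\<^sup>2) \<le> (a * real d ^ 2 + 1) / (real d * (real d + 1))"
proof -
  define N where "N = d\<^sup>2"
  define r where "r = real d"
  define b where "b = (1 - r * a) / (r * (r\<^sup>2 - 1))"
  have a: "1 / r ^ 3 < a" "a \<le> 1 / r\<^sup>2"
    and psd: "\<And>i. i < N \<Longrightarrow> psd d (P i)" and sum_id: "mat_sum d P {..<N} = 1\<^sub>m d"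
    and PP_same: "\<And>i. i < N \<Longrightarrow> mat_trace (P i * P i) = of_real a"
    and PP_diff: "\<And>i j. i < N \<Longrightarrow> j < N \<Longrightarrow> i \<noteq> j \<Longrightarrow> mat_trace (P i * P j) = of_real b"
    using P unfolding general_sic_povm_def N_def r_def b_def by auto
  \<comment> \<open>For d = 0 both bounds on \<open>a\<close> are 1 / 0 = 0, and for d = 1 both are
    1; no \<open>a\<close> lies strictly above one and at most at the other.\<close>
  have d: "d \<ge> 2"
  proof (rule ccontr)
    assume "\<not> ?thesis"
    then have "d = 0 \<or> d = 1" by auto
    then show False using a by (auto simp: r_def)
  qed
  then have r: "r \<ge> 2" by (simp add: r_def)
  then have r2: "r\<^sup>2 > 1" by (intro one_less_power) auto
  have psdS: "psd d S" and trS: "mat_trace S = 1" using S by (auto simp: is_state_def)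
  note S' = psd_D[OF psdS] and P' = psd_D[OF psd]
  define q where "q i = Re (mat_trace (P i * S))" for i
  have q: "mat_trace (P i * S) = of_real (q i)" if "i < N" for i
    unfolding q_def using trace_mult_hermitian_real[OF P'[OF that] S'] .
  have "mat_trace (S * 1\<^sub>m d) = (\<Sum>i<N. mat_trace (S * P i))"
    unfolding sum_id[symmetric] using P'(1) by (intro trace_mult_mat_sum[OF S'(1)]) auto
  also have "\<dots> = (\<Sum>i<N. of_real (q i))"
    using trace_mult_commute[OF S'(1) P'(1)] q by (intro sum.cong) auto
  finally have "complex_of_real (\<Sum>i<N. q i) = 1" using trS S'(1) by simp
  then have q1: "(\<Sum>i<N. q i) = 1" by (simp only: of_real_eq_1_iff)
  have key: "2 * (\<Sum>i<N. x i * q i) \<le> 1 + (a - b) * (\<Sum>i<N. (x i)\<^sup>2) + b * (\<Sum>i<N. x i)\<^sup>2" for x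
  proof -
    have "2 * (\<Sum>i<N. x i * q i) \<le> Re (mat_trace (S * S)) + (\<Sum>i<N. \<Sum>j<N. x i * x j * Re (mat_trace (P i * P j)))"
      unfolding q_def by (rule hilbert_schmidt_expand[OF S' P'])
    also have "(\<Sum>i<N. \<Sum>j<N. x i * x j * Re (mat_trace (P i * P j)))
       = (\<Sum>i<N. \<Sum>j<N. (if i = j then (a - b) * (x i * x j) else 0) + b * (x i * x j))"
      by (intro sum.cong refl) (auto simp: PP_same PP_diff algebra_simps)
    also have "\<dots> = (a - b) * (\<Sum>i<N. (x i)\<^sup>2) + b * (\<Sum>i<N. x i)\<^sup>2"
      by (simp add: sum.distrib power2_eq_square sum_product flip: sum_distrib_left)
    finally show ?thesis using state_purity_le[OF S] by linarith
  qed
  define Q where "Q = (\<Sum>i<N. (q i)\<^sup>2)"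
  \<comment> \<open>Divided by \<open>r\<close> this is a + (r^2 - 1) b = 1 / r, the row sum of the
    Gram matrix.\<close>
  have br: "b * r * (r\<^sup>2 - 1) = 1 - r * a"
  proof -
    have "r * (r\<^sup>2 - 1) > 0" using r r2 by (intro mult_pos_pos) linarith+
    then have "r * (r\<^sup>2 - 1) \<noteq> 0" by linarith
    then have "b * (r * (r\<^sup>2 - 1)) = 1 - r * a" unfolding b_def by (rule nonzero_eq_divide_eq[THEN iffD1, OF _ refl])
    then show ?thesis by (simp only: mult.assoc)
  qed
  have ab: "(a - b) * r = 1 - b * r ^ 3"
    using br by (simp add: algebra_simps power2_eq_square power3_eq_cube)
  \<comment> \<open>The strict lower bound on \<open>a\<close> enters here: it makes 1 - b r^3,
    which equals r (a - b), positive.\<close>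
  have "a * r ^ 3 > 1" using a(1) r by (simp add: field_simps)
  moreover have "(1 - b * r ^ 3) * (r\<^sup>2 - 1) = r\<^sup>2 - 1 - r\<^sup>2 * (b * r * (r\<^sup>2 - 1))"
    by (simp add: algebra_simps power2_eq_square power3_eq_cube)
  then have "(1 - b * r ^ 3) * (r\<^sup>2 - 1) = a * r ^ 3 - 1"
    unfolding br by (simp add: algebra_simps power2_eq_square power3_eq_cube)
  ultimately have "(1 - b * r ^ 3) * (r\<^sup>2 - 1) > 0" by linarith
  then have pos: "1 - b * r ^ 3 > 0" using r2 zero_less_mult_pos2[of "1 - b * r ^ 3" "r\<^sup>2 - 1"] by linarith
  \<comment> \<open>\<open>t\<close> is 1 / (a - b). The projection coefficients solve (a - b) x_i +
    b X = q_i, where X is the sum of all x_i. Adding up these r^2 equations gives X = r, whence x_i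
    = t q_i - b r t; the constant term is \<open>s\<close>.\<close>
  define t where "t = r / (1 - b * r ^ 3)"
  have t: "t * (1 - b * r ^ 3) = r" unfolding t_def using pos by simp
  have t2: "(a - b) * t = 1" unfolding t_def ab[symmetric] using pos ab r by (auto simp: field_simps)
  define s where "s = - b * r * t"
  have N: "real N = r\<^sup>2" by (simp add: N_def r_def)
  \<comment> \<open>the coefficients of the orthogonal projection of \<open>S\<close> onto the span of the \<open>P i\<close>\<close>
  define x where "x i = t * q i + s" for i
  have x1: "(\<Sum>i<N. x i * q i) = t * Q + s"
    unfolding x_def Q_def using q1
    by (simp add: distrib_right sum.distrib power2_eq_square mult.assoc flip: sum_distrib_left)
  have x2: "(\<Sum>i<N. x i) = t + r\<^sup>2 * s"
    unfolding x_def using q1 by (simp add: sum.distrib N flip: sum_distrib_left)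
  have "(\<Sum>i<N. (x i)\<^sup>2) = (\<Sum>i<N. t\<^sup>2 * (q i)\<^sup>2 + 2 * t * s * q i + s\<^sup>2)"
    unfolding x_def by (intro sum.cong refl) (simp add: power2_eq_square algebra_simps)
  also have "\<dots> = t\<^sup>2 * Q + 2 * t * s + r\<^sup>2 * s\<^sup>2"
    unfolding Q_def using q1 by (simp add: sum.distrib N flip: sum_distrib_left)
  finally have x3: "(\<Sum>i<N. (x i)\<^sup>2) = t\<^sup>2 * Q + 2 * t * s + r\<^sup>2 * s\<^sup>2" .
  have e1: "t + r\<^sup>2 * s = r"
    using t unfolding s_def by (simp add: algebra_simps power2_eq_square power3_eq_cube)
  have "2 * (t * Q + s) \<le> 1 + (a - b) * (t\<^sup>2 * Q + 2 * t * s + r\<^sup>2 * s\<^sup>2) + b * r\<^sup>2"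
    using key[of x] unfolding x1 x2 x3 e1 .
  also have "(a - b) * (t\<^sup>2 * Q + 2 * t * s + r\<^sup>2 * s\<^sup>2) = ((a - b) * t) * (t * Q + 2 * s) + ((a - b) * t) * (- b * r ^ 3 * s)"
    unfolding s_def by (simp add: algebra_simps power2_eq_square power3_eq_cube)
  also have "\<dots> = t * Q + 2 * s - b * r ^ 3 * s" unfolding t2 by simp
  also have "b * r ^ 3 * s = b * r * (r\<^sup>2 * s)" by (simp add: power2_eq_square power3_eq_cube)
  also have "r\<^sup>2 * s = r - t" using e1 by simp
  finally have "t * Q \<le> 1 + b * r * t" by (simp add: algebra_simps power2_eq_square)
  \<comment> \<open>As (a - b) t = 1, multiplying by the positive number a - b isolates
    \<open>Q\<close>.\<close>
  then have "(a - b) * (t * Q) \<le> (a - b) * (1 + b * r * t)"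
    using zero_less_mult_pos2[of "a - b" r] pos ab r by (intro mult_left_mono) linarith+
  also have "(a - b) * (t * Q) = Q" using t2 by (simp add: mult.assoc[symmetric])
  also have "(a - b) * (1 + b * r * t) = (a - b) + b * r * ((a - b) * t)" by (simp add: algebra_simps)
  also have "\<dots> = a + b * (r - 1)" unfolding t2 by (simp add: algebra_simps)
  also have "\<dots> = (a * r\<^sup>2 + 1) / (r * (r + 1))"
  proof -
    have "(a + b * (r - 1)) * (r * (r + 1)) = a * r * (r + 1) + b * r * (r\<^sup>2 - 1)"
      by (simp add: algebra_simps power2_eq_square)
    also have "\<dots> = a * r\<^sup>2 + 1" unfolding br by (simp add: algebra_simps power2_eq_square)
    finally show ?thesis using r by (simp add: nonzero_eq_divide_eq)
  qed
  finally have "Q \<le> (a * r\<^sup>2 + 1) / (r * (r + 1))" .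
  moreover have "(\<Sum>i<N. (cmod (mat_trace (P i * S)))\<^sup>2) = Q"
    unfolding Q_def by (intro sum.cong) (auto simp: q)
  ultimately show ?thesis by (simp add: N_def r_def)
qed

section \<open>Traces of tensor products\<close>

text \<open>Decodes a tensor product index, as \<open>tensor_mat\<close> encodes it, into its pair
  of indices. The induction splits off the last block of length \<open>n\<close>.\<close>

lemma sum_div_mod:
  fixes f :: "nat \<Rightarrow> nat \<Rightarrow> 'a :: comm_monoid_add"
  shows "(\<Sum>i<m * n. f (i div n) (i mod n)) = (\<Sum>x<m. \<Sum>y<n. f x y)"
proof (induction m)
  case (Suc m)
  have "(\<Sum>i<Suc m * n. f (i div n) (i mod n))
    = (\<Sum>i<m * n. f (i div n) (i mod n)) + (\<Sum>i = m * n..<m * n + n. f (i div n) (i mod n))"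
    by (simp add: lessThan_atLeast0 add.commute sum.atLeastLessThan_concat)
  also have "(\<Sum>i = m * n..<m * n + n. f (i div n) (i mod n)) = (\<Sum>y<n. f m y)"
    using sum.shift_bounds_nat_ivl[of "\<lambda>i. f (i div n) (i mod n)" 0 "m * n" n]
    by (auto simp: lessThan_atLeast0 add.commute intro!: sum.cong)
  finally show ?case by (simp add: Suc)
qed simp

lemma tensor_carrier:
  "A \<in> carrier_mat n n \<Longrightarrow> B \<in> carrier_mat m m \<Longrightarrow> tensor_mat A B \<in> carrier_mat (n * m) (n * m)"
  by (simp add: tensor_mat_def)

text \<open>Decoding both the row and the column index turns the trace into a fourfold sum, which
  factors.\<close>

lemma trace_tensor_mult:
  assumes A: "A \<in> carrier_mat n n" "A' \<in> carrier_mat n n" and B: "B \<in> carrier_mat m m" "B' \<in> carrier_mat m m"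
  shows "mat_trace (tensor_mat A B * tensor_mat A' B') = mat_trace (A * A') * mat_trace (B * B')"
proof -
  define F where "F x y z w = (A $$ (x, z) * B $$ (y, w)) * (A' $$ (z, x) * B' $$ (w, y))" for x y z w
  have "mat_trace (tensor_mat A B * tensor_mat A' B')
    = (\<Sum>i<n * m. \<Sum>j<n * m. F (i div m) (i mod m) (j div m) (j mod m))"
    unfolding trace_mult[OF tensor_carrier[OF A(1) B(1)] tensor_carrier[OF A(2) B(2)]]
    using A B by (intro sum.cong refl) (simp add: tensor_mat_def F_def)
  also have "\<dots> = (\<Sum>i<n * m. \<Sum>z<n. \<Sum>w<m. F (i div m) (i mod m) z w)"
    by (intro sum.cong refl sum_div_mod)
  also have "\<dots> = (\<Sum>x<n. \<Sum>y<m. \<Sum>z<n. \<Sum>w<m. F x y z w)"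
    by (rule sum_div_mod)
  also have "\<dots> = (\<Sum>x<n. \<Sum>z<n. \<Sum>y<m. \<Sum>w<m. F x y z w)"
    by (intro sum.cong refl sum.swap)
  also have "\<dots> = (\<Sum>x<n. \<Sum>z<n. (A $$ (x, z) * A' $$ (z, x)) * (\<Sum>y<m. \<Sum>w<m. B $$ (y, w) * B' $$ (w, y)))"
    by (simp add: F_def sum_distrib_left mult_ac)
  also have "\<dots> = mat_trace (A * A') * mat_trace (B * B')"
    unfolding trace_mult[OF A] trace_mult[OF B] by (simp add: sum_distrib_right)
  finally show ?thesis .
qed

section \<open>Correlation matrices of separable states\<close>

theorem theorem1:
  fixes dA dB :: nat and aA aB :: real
    and PA PB :: "nat \<Rightarrow> complex mat" and \<rho> :: "complex mat"
  assumes "general_sic_povm dA aA PA"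
    and "general_sic_povm dB aB PB"
    and "is_state (dA * dB) \<rho>"
    and "separable dA dB \<rho>"
  shows "trace_norm (correlation_mat dA dB PA PB \<rho>)
    \<le> sqrt ((aA * real dA ^ 2 + 1) / (real dA * (real dA + 1)))
      * sqrt ((aB * real dB ^ 2 + 1) / (real dB * (real dB + 1)))"
proof -
  let ?cA = "sqrt ((aA * real dA ^ 2 + 1) / (real dA * (real dA + 1)))"
  let ?cB = "sqrt ((aB * real dB ^ 2 + 1) / (real dB * (real dB + 1)))"
  obtain m and p :: "nat \<Rightarrow> real" and \<sigma> \<tau> where
    p: "\<And>k. k < m \<Longrightarrow> 0 \<le> p k" and \<sigma>: "\<And>k. k < m \<Longrightarrow> is_state dA (\<sigma> k)" and \<tau>: "\<And>k. k < m \<Longrightarrow> is_state dB (\<tau> k)"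
    and p1: "(\<Sum>k<m. p k) = 1"
    and \<rho>: "\<rho> = mat_sum (dA * dB) (\<lambda>k. complex_of_real (p k) \<cdot>\<^sub>m tensor_mat (\<sigma> k) (\<tau> k)) {..<m}"
    using assms(4) unfolding separable_def by blast
  have \<sigma>c: "\<sigma> k \<in> carrier_mat dA dA" and \<tau>c: "\<tau> k \<in> carrier_mat dB dB" if "k < m" for k
    using \<sigma>[OF that] \<tau>[OF that] by (auto simp: is_state_def psd_def)
  have PA: "PA i \<in> carrier_mat dA dA" if "i < dA\<^sup>2" for i
    using assms(1) that by (auto simp: general_sic_povm_def psd_def)
  have PB: "PB i \<in> carrier_mat dB dB" if "i < dB\<^sup>2" for i
    using assms(2) that by (auto simp: general_sic_povm_def psd_def)
  \<comment> \<open>The weight \<open>p k\<close> goes into the left factor, so that the correlation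
    matrix is a plain sum of outer products.\<close>
  define u where "u k i = of_real (p k) * mat_trace (PA i * \<sigma> k)" for k i
  define v where "v k j = mat_trace (PB j * \<tau> k)" for k j
  let ?M = "correlation_mat dA dB PA PB \<rho>"
  have "trace_norm ?M \<le> (\<Sum>k<m. sqrt (\<Sum>i<dA\<^sup>2. (cmod (u k i))\<^sup>2) * sqrt (\<Sum>j<dB\<^sup>2. (cmod (v k j))\<^sup>2))"
  proof (rule trace_norm_le)
    show "?M \<in> carrier_mat (dA\<^sup>2) (dB\<^sup>2)" by (simp add: correlation_mat_def)
    fix i j assume ij: "i < dA\<^sup>2" "j < dB\<^sup>2"
    have "?M $$ (i, j) = mat_trace (tensor_mat (PA i) (PB j) * \<rho>)"
      using ij by (simp add: correlation_mat_def)
    also have "\<dots> = (\<Sum>k<m. mat_trace (tensor_mat (PA i) (PB j) * (of_real (p k) \<cdot>\<^sub>m tensor_mat (\<sigma> k) (\<tau> k))))"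
      unfolding \<rho> using \<sigma>c \<tau>c
      by (intro trace_mult_mat_sum tensor_carrier PA PB ij smult_carrier_mat) auto
    also have "\<dots> = (\<Sum>k<m. u k i * v k j)"
      using ij \<sigma>c \<tau>c by (intro sum.cong refl)
        (simp add: u_def v_def trace_mult_smult[OF tensor_carrier[OF PA PB] tensor_carrier[OF \<sigma>c \<tau>c]]
          trace_tensor_mult[OF PA \<sigma>c PB \<tau>c])
    finally show "?M $$ (i, j) = (\<Sum>k<m. u k i * v k j)" .
  qed
  \<comment> \<open>The SIC-POVM bound is applied to the local states \<open>\<sigma> k\<close> and
    \<open>\<tau> k\<close>; the weights then add up to 1.\<close>
  also have "\<dots> \<le> (\<Sum>k<m. (p k * ?cA) * ?cB)"
  proof (intro sum_mono mult_mono)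
    fix k assume "k \<in> {..<m}"
    then have k: "k < m" by simp
    have "(\<Sum>i<dA\<^sup>2. (cmod (u k i))\<^sup>2) = (p k)\<^sup>2 * (\<Sum>i<dA\<^sup>2. (cmod (mat_trace (PA i * \<sigma> k)))\<^sup>2)"
      by (simp add: u_def norm_mult power_mult_distrib sum_distrib_left)
    also have "sqrt \<dots> = p k * sqrt (\<Sum>i<dA\<^sup>2. (cmod (mat_trace (PA i * \<sigma> k)))\<^sup>2)"
      using p[OF k] by (simp add: real_sqrt_mult)
    finally show "sqrt (\<Sum>i<dA\<^sup>2. (cmod (u k i))\<^sup>2) \<le> p k * ?cA"
      using mult_left_mono[OF real_sqrt_le_mono[OF general_sic_povm_bound[OF assms(1) \<sigma>[OF k]]] p[OF k]] by simp
    show "sqrt (\<Sum>j<dB\<^sup>2. (cmod (v k j))\<^sup>2) \<le> ?cB"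
      unfolding v_def by (rule real_sqrt_le_mono[OF general_sic_povm_bound[OF assms(2) \<tau>[OF k]]])
    \<comment> \<open>\<open>mult_mono\<close> asks for a nonnegative \<open>p k * ?cA\<close>; the
      expression under the root is nonnegative because it bounds a sum of squares.\<close>
    have "0 \<le> (\<Sum>i<dA\<^sup>2. (cmod (mat_trace (PA i * \<sigma> k)))\<^sup>2)" by (intro sum_nonneg) simp
    then have "0 \<le> ?cA"
      using general_sic_povm_bound[OF assms(1) \<sigma>[OF k]] by (intro real_sqrt_ge_zero) linarith
    then show "0 \<le> p k * ?cA" using p[OF k] by simp
  qed (auto intro!: sum_nonneg)
  also have "\<dots> = ?cA * ?cB" by (simp only: mult.assoc p1 mult_1_left flip: sum_distrib_right)
  finally show ?thesis .
qed

end
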